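(* Let $\mathcal{X}=\langle X,\tau,\le,\eta_1,\eta_2\rangle$ be a modal Esakia space and let $\epsilon_X\colon X\to X(\mathcal{U}(X))$ be defined by $\epsilon_X(x)=\{U\in\mathcal{U}(X): x\in U\}$. Then $\epsilon_X$ is a homeomorphism and order isomorphism between $\langle X,\tau,\le\rangle$ and $\langle X(\mathcal{U}(X)),\tau_{\mathcal{U}(X)},\subseteq\rangle$ that satisfies, for every $x\in X$: (1) $\eta_{\Box_{\eta_1}}(\epsilon_X(x))=\{\epsilon_X[U]: U\in\eta_1(x)\}$; (2) $\eta_{\Diamond_{\eta_2}}(\epsilon_X(x))=\{\epsilon_X[D]: D\in\eta_2(x)\}$.
   Context: An Esakia space is a compact ordered space $\langle X,\tau,\le\rangle$ such that if $x\not\le y$ there is a clopen up-set containing $x$ but not $y$, and ${\downarrow}U$ is clopen for every clopen $U$; $\mathcal{U}(X)$, $\mathcal{D}(X)$ are the clopen up-sets and down-sets, and $\mathcal{U}(X)$ is a Heyting algebra. A modal Esakia space is $\langle X,\tau,\le,\eta_1,\eta_2\rangle$ with $\eta_1,\eta_2\colon X\to\mathcal{P}(\mathcal{P}(X))$ such that for all $x$ and $U,V\in\mathcal{U}(X)$: (1) $\eta_1(x)\subseteq\mathcal{U}(X)$, $\eta_2(x)\subseteq\mathcal{D}(X)$; (2) $\Box_{\eta_1}(U)=\{x: U\in\eta_1(x)\}$ and $\Diamond_{\eta_2}(U)=\{x: X\setminus U\notin\eta_2(x)\}$ are clopen up-sets; (3) if $U\in\eta_1(x)$ then ${\downarrow}U\cup(X\setminus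 V)\in\eta_2(x)$. Then $\langle\mathcal{U}(X),\Box_{\eta_1},\Diamond_{\eta_2}\rangle$ is a modal Heyting algebra. For a modal Heyting algebra $\langle\mathbf{H},\Box,\Diamond\rangle$: $X(\mathbf{H})$ is the set of prime filters ordered by inclusion, $\sigma_{\mathbf{H}}(a)=\{P: a\in P\}$, $\tau_{\mathbf{H}}$ is generated by the $\sigma_{\mathbf{H}}(a)$ and their complements, $\eta_\Box(P)=\{\sigma_{\mathbf{H}}(a): \Box a\in P\}$, $\eta_\Diamond(P)=\mathcal{D}(X(\mathbf{H}))\setminus\{X(\mathbf{H})\setminus\sigma_{\mathbf{H}}(a): \Diamond a\in P\}$. Here these are applied with $\mathbf{H}=\mathcal{U}(X)$, $\Box=\Box_{\eta_1}$, $\Diamond=\Diamond_{\eta_2}$. *)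

theory Defs
  imports "HOL-Analysis.Abstract_Topology" "HOL-Algebra.Lattice"
begin

definition downset_of :: "'a rel \<Rightarrow> 'a set \<Rightarrow> 'a set" where
  "downset_of r U = {y. \<exists>x\<in>U. (y, x) \<in> r}"

definition clopenin :: "'a topology \<Rightarrow> 'a set \<Rightarrow> bool" where
  "clopenin X U \<longleftrightarrow> openin X U \<and> closedin X U"

definition clopen_upsets :: "'a topology \<Rightarrow> 'a rel \<Rightarrow> 'a set set" where
  "clopen_upsets X r = {U. clopenin X U \<and> (\<forall>x y. x \<in> U \<and> (x, y) \<in> r \<longrightarrow> y \<in> U)}"

definition clopen_downsets :: "'a topology \<Rightarrow> 'a rel \<Rightarrow> 'a set set" where
  "clopen_downsets X r = {D. clopenin X D \<and> (\<forall>x y. x \<in> D \<and> (y, x) \<in> r \<longrightarrow> y \<in> D)}"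

locale esakia_space =
  fixes X :: "'a topology" and r :: "'a rel"
  assumes compact: "compact_space X"
    and order: "partial_order_on (topspace X) r"
    and separation:
      "\<lbrakk>x \<in> topspace X; y \<in> topspace X; (x, y) \<notin> r\<rbrakk>
        \<Longrightarrow> \<exists>U\<in>clopen_upsets X r. x \<in> U \<and> y \<notin> U"
    and clopen_downset_of: "clopenin X U \<Longrightarrow> clopenin X (downset_of r U)"

definition box_of :: "'a topology \<Rightarrow> ('a \<Rightarrow> 'a set set) \<Rightarrow> 'a set \<Rightarrow> 'a set" where
  "box_of X \<eta>\<^sub>1 U = {x \<in> topspace X. U \<in> \<eta>\<^sub>1 x}"

definition diamond_of :: "'a topology \<Rightarrow> ('a \<Rightarrow> 'a set set) \<Rightarrow> 'a set \<Rightarrow> 'a set" where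
  "diamond_of X \<eta>\<^sub>2 U = {x \<in> topspace X. topspace X - U \<notin> \<eta>\<^sub>2 x}"

locale modal_esakia_space = esakia_space X r
  for X :: "'a topology" and r :: "'a rel" +
  fixes \<eta>\<^sub>1 \<eta>\<^sub>2 :: "'a \<Rightarrow> 'a set set"
  assumes eta1_upsets: "x \<in> topspace X \<Longrightarrow> \<eta>\<^sub>1 x \<subseteq> clopen_upsets X r"
    and eta2_downsets: "x \<in> topspace X \<Longrightarrow> \<eta>\<^sub>2 x \<subseteq> clopen_downsets X r"
    and box_closed: "U \<in> clopen_upsets X r \<Longrightarrow> box_of X \<eta>\<^sub>1 U \<in> clopen_upsets X r"
    and diamond_closed: "U \<in> clopen_upsets X r \<Longrightarrow> diamond_of X \<eta>\<^sub>2 U \<in> clopen_upsets X r"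
    and interaction:
      "\<lbrakk>x \<in> topspace X; U \<in> clopen_upsets X r; V \<in> clopen_upsets X r; U \<in> \<eta>\<^sub>1 x\<rbrakk>
        \<Longrightarrow> downset_of r U \<union> (topspace X - V) \<in> \<eta>\<^sub>2 x"

text \<open>
  The Heyting operations are determined by the order, so the signature of a modal Heyting algebra
  is an ordered carrier together with the two modal operators.
\<close>

record 'a modal_gorder = "'a gorder" +
  box :: "'a \<Rightarrow> 'a"
  diamond :: "'a \<Rightarrow> 'a"

locale heyting_algebra = lattice H + weak_partial_order_bottom H + weak_partial_order_top H
  for H (structure) +
  assumes imp_exists:
    "\<lbrakk>a \<in> carrier H; b \<in> carrier H\<rbrakk>
      \<Longrightarrow> \<exists>c. greatest H c {x \<in> carrier H. a \<sqinter> x \<sqsubseteq> b}"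

definition clopen_upset_algebra ::
  "'a topology \<Rightarrow> 'a rel \<Rightarrow> ('a \<Rightarrow> 'a set set) \<Rightarrow> ('a \<Rightarrow> 'a set set) \<Rightarrow> 'a set modal_gorder" where
  "clopen_upset_algebra X r \<eta>\<^sub>1 \<eta>\<^sub>2 =
    \<lparr>carrier = clopen_upsets X r, eq = (=), le = (\<subseteq>),
     box = box_of X \<eta>\<^sub>1, diamond = diamond_of X \<eta>\<^sub>2\<rparr>"

definition lattice_filter :: "('a, 'b) gorder_scheme \<Rightarrow> 'a set \<Rightarrow> bool" where
  "lattice_filter H F \<longleftrightarrow> F \<subseteq> carrier H \<and> F \<noteq> {} \<and>
    (\<forall>a\<in>F. \<forall>b\<in>F. a \<sqinter>\<^bsub>H\<^esub> b \<in> F) \<and>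
    (\<forall>a\<in>F. \<forall>b\<in>carrier H. a \<sqsubseteq>\<^bsub>H\<^esub> b \<longrightarrow> b \<in> F)"

definition prime_filters :: "('a, 'b) gorder_scheme \<Rightarrow> 'a set set" where
  "prime_filters H = {P. lattice_filter H P \<and> P \<noteq> carrier H \<and>
    (\<forall>a\<in>carrier H. \<forall>b\<in>carrier H. a \<squnion>\<^bsub>H\<^esub> b \<in> P \<longrightarrow> a \<in> P \<or> b \<in> P)}"

definition prime_filter_order :: "('a, 'b) gorder_scheme \<Rightarrow> 'a set rel" where
  "prime_filter_order H = {(P, Q). P \<in> prime_filters H \<and> Q \<in> prime_filters H \<and> P \<subseteq> Q}"

definition sigma_map :: "('a, 'b) gorder_scheme \<Rightarrow> 'a \<Rightarrow> 'a set set" where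
  "sigma_map H a = {P \<in> prime_filters H. a \<in> P}"

definition prime_filter_topology :: "('a, 'b) gorder_scheme \<Rightarrow> 'a set topology" where
  "prime_filter_topology H = topology_generated_by
    (sigma_map H ` carrier H \<union> (\<lambda>a. prime_filters H - sigma_map H a) ` carrier H)"

definition eta_box :: "('a, 'b) modal_gorder_scheme \<Rightarrow> 'a set \<Rightarrow> 'a set set set" where
  "eta_box H P = {sigma_map H a |a. a \<in> carrier H \<and> box H a \<in> P}"

definition eta_diamond :: "('a, 'b) modal_gorder_scheme \<Rightarrow> 'a set \<Rightarrow> 'a set set set" where
  "eta_diamond H P =
    clopen_downsets (prime_filter_topology H) (prime_filter_order H) -
    {prime_filters H - sigma_map H a |a. a \<in> carrier H \<and> diamond H a \<in> P}"

definition epsilon :: "'a topology \<Rightarrow> 'a rel \<Rightarrow> 'a \<Rightarrow> 'a set set" where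
  "epsilon X r x = {U \<in> clopen_upsets X r. x \<in> U}"

definition order_isomorphism :: "'a set \<Rightarrow> 'a rel \<Rightarrow> 'b set \<Rightarrow> 'b rel \<Rightarrow> ('a \<Rightarrow> 'b) \<Rightarrow> bool" where
  "order_isomorphism A r B s f \<longleftrightarrow>
    bij_betw f A B \<and> (\<forall>x\<in>A. \<forall>y\<in>A. (x, y) \<in> r \<longleftrightarrow> (f x, f y) \<in> s)"

lemma topspace_prime_filter_topology:
  assumes "carrier H \<noteq> {}"
  shows "topspace (prime_filter_topology H) = prime_filters H"
  using assms by (auto simp: prime_filter_topology_def sigma_map_def)

lemma clopen_upsets_Un:
  "\<lbrakk>U \<in> clopen_upsets X r; V \<in> clopen_upsets X r\<rbrakk> \<Longrightarrow> U \<union> V \<in> clopen_upsets X r"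
  by (auto simp: clopen_upsets_def clopenin_def)

lemma clopen_upsets_Int:
  "\<lbrakk>U \<in> clopen_upsets X r; V \<in> clopen_upsets X r\<rbrakk> \<Longrightarrow> U \<inter> V \<in> clopen_upsets X r"
  by (auto simp: clopen_upsets_def clopenin_def)

context esakia_space
begin

lemma topspace_in_clopen_upsets: "topspace X \<in> clopen_upsets X r"
  using order by (auto simp: clopen_upsets_def clopenin_def partial_order_on_def preorder_on_def)

lemma empty_in_clopen_upsets: "{} \<in> clopen_upsets X r"
  by (auto simp: clopen_upsets_def clopenin_def)

lemma imp_in_clopen_upsets:
  assumes "U \<in> clopen_upsets X r" "V \<in> clopen_upsets X r"
  shows "topspace X - downset_of r (U - V) \<in> clopen_upsets X r"
proof -
  have "clopenin X (U - V)"
    using assms by (auto simp: clopen_upsets_def clopenin_def)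
  then have "clopenin X (downset_of r (U - V))"
    by (rule clopen_downset_of)
  then have "clopenin X (topspace X - downset_of r (U - V))"
    by (auto simp: clopenin_def)
  moreover have "r \<subseteq> topspace X \<times> topspace X" "trans r"
    using order by (auto simp: partial_order_on_def preorder_on_def)
  ultimately show ?thesis
    by (auto simp: clopen_upsets_def downset_of_def dest: transD)
qed

lemma lattice_clopen_upset_algebra: "lattice (clopen_upset_algebra X r \<eta>\<^sub>1 \<eta>\<^sub>2)"
proof -
  let ?H = "clopen_upset_algebra X r \<eta>\<^sub>1 \<eta>\<^sub>2"
  interpret partial_order ?H
    by unfold_locales (auto simp: clopen_upset_algebra_def)
  show ?thesis
  proof unfold_locales
    fix U V assume "U \<in> carrier ?H" "V \<in> carrier ?H"
    then have "least ?H (U \<union> V) (Upper ?H {U, V})" "greatest ?H (U \<inter> V) (Lower ?H {U, V})"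
      by (auto simp: clopen_upset_algebra_def least_def Upper_def greatest_def Lower_def
          clopen_upsets_Un clopen_upsets_Int)
    then show "\<exists>s. least ?H s (Upper ?H {U, V})" "\<exists>s. greatest ?H s (Lower ?H {U, V})"
      by blast+
  qed
qed

lemma
  assumes "U \<in> clopen_upsets X r" "V \<in> clopen_upsets X r"
  shows join_clopen_upset_algebra: "U \<squnion>\<^bsub>clopen_upset_algebra X r \<eta>\<^sub>1 \<eta>\<^sub>2\<^esub> V = U \<union> V"
    and meet_clopen_upset_algebra: "U \<sqinter>\<^bsub>clopen_upset_algebra X r \<eta>\<^sub>1 \<eta>\<^sub>2\<^esub> V = U \<inter> V"
proof -
  let ?H = "clopen_upset_algebra X r \<eta>\<^sub>1 \<eta>\<^sub>2"
  interpret lattice ?H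
    by (rule lattice_clopen_upset_algebra)
  have H: "carrier ?H = clopen_upsets X r" "le ?H = (\<subseteq>)"
    by (simp_all add: clopen_upset_algebra_def)
  show "U \<squnion>\<^bsub>?H\<^esub> V = U \<union> V"
    using join_left[of U V] join_right[of U V] join_le[of U "U \<union> V" V]
    by (simp add: H assms clopen_upsets_Un subset_antisym)
  show "U \<sqinter>\<^bsub>?H\<^esub> V = U \<inter> V"
    using meet_left[of U V] meet_right[of U V] meet_le[of "U \<inter> V" U V]
    by (simp add: H assms clopen_upsets_Int subset_antisym)
qed

lemma heyting_algebra_clopen_upset_algebra:
  "heyting_algebra (clopen_upset_algebra X r \<eta>\<^sub>1 \<eta>\<^sub>2)"
proof -
  interpret lattice "clopen_upset_algebra X r \<eta>\<^sub>1 \<eta>\<^sub>2"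
    by (rule lattice_clopen_upset_algebra)
  have r: "r \<subseteq> topspace X \<times> topspace X" "refl_on (topspace X) r"
    using order by (auto simp: partial_order_on_def preorder_on_def)
  have sub: "U \<subseteq> topspace X" if "U \<in> clopen_upsets X r" for U
    using that by (auto simp: clopen_upsets_def clopenin_def dest: openin_subset)
  show ?thesis
  proof (unfold_locales, goal_cases)
    case 1
    show ?case
      by (intro exI[of _ "{}"])
        (auto simp: least_def clopen_upset_algebra_def empty_in_clopen_upsets)
  next
    case 2
    show ?case
      using sub by (intro exI[of _ "topspace X"])
        (auto simp: greatest_def clopen_upset_algebra_def topspace_in_clopen_upsets)
  next
    case (3 U V)
    then have UV: "U \<in> clopen_upsets X r" "V \<in> clopen_upsets X r"
      by (auto simp: clopen_upset_algebra_def)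
    let ?C = "topspace X - downset_of r (U - V)"
    have "U \<inter> ?C \<subseteq> V"
      using r by (auto simp: downset_of_def refl_on_def)
    moreover have "W \<subseteq> ?C" if "W \<in> clopen_upsets X r" "U \<inter> W \<subseteq> V" for W
      using that sub[OF that(1)] by (auto simp: downset_of_def clopen_upsets_def)
    moreover have "carrier (clopen_upset_algebra X r \<eta>\<^sub>1 \<eta>\<^sub>2) = clopen_upsets X r"
        "le (clopen_upset_algebra X r \<eta>\<^sub>1 \<eta>\<^sub>2) = (\<subseteq>)"
      by (simp_all add: clopen_upset_algebra_def)
    ultimately show ?case
      using UV imp_in_clopen_upsets[OF UV]
      by (intro exI[of _ ?C])
        (simp add: greatest_def meet_clopen_upset_algebra cong: conj_cong)
  qed
qed

end

end

theory Submission
  imports Defs "HOL-Analysis.T1_Spaces"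
begin

text \<open>The crux is that every prime filter P of clopen up-sets is the trace of a point
  (\<open>prime_filter_eq_epsilon\<close>). The members of P together with the complements of the
  non-members are closed sets with the finite intersection property, so compactness yields a common
  point, and such a point determines P. Order separation makes \<open>epsilon\<close> an order
  embedding (\<open>epsilon_subset_iff\<close>), hence injective by antisymmetry. It is therefore an
  order isomorphism onto the prime filters.

  Under this bijection \<open>sigma_map\<close> sends a clopen up-set to its image
  (\<open>sigma_map_clopen_upset_algebra\<close>). Subbasic open sets thus pull back to clopen
  up-sets and their complements, so \<open>epsilon\<close> is continuous; a continuous bijection
  from a compact space to a Hausdorff space is a homeomorphism
  (\<open>homeomorphic_map_epsilon\<close>).

  For the box, U lies in \<open>\<eta>\<^sub>1 x\<close> exactly when
  \<open>box_of X \<eta>\<^sub>1 U\<close> belongs to \<open>epsilon X r x\<close>. For the diamond,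
  the clopen down-sets of the dual are the images of those of X, and the removed ones are the images
  of those outside \<open>\<eta>\<^sub>2 x\<close>; what remains is the image of
  \<open>\<eta>\<^sub>2 x\<close>.\<close>

section \<open>Complements, transport of clopen down-sets, and separation of prime filters\<close>

lemma clopen_downsets_Diff:
  assumes "r \<subseteq> topspace X \<times> topspace X" "U \<in> clopen_upsets X r"
  shows "topspace X - U \<in> clopen_downsets X r"
  using assms by (auto simp: clopen_upsets_def clopen_downsets_def clopenin_def)

lemma clopen_upsets_Diff:
  assumes "r \<subseteq> topspace X \<times> topspace X" "D \<in> clopen_downsets X r"
  shows "topspace X - D \<in> clopen_upsets X r"
  using assms by (auto simp: clopen_upsets_def clopen_downsets_def clopenin_def)

lemma clopen_downsets_subset: "D \<in> clopen_downsets X r \<Longrightarrow> D \<subseteq> topspace X"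
  by (auto simp: clopen_downsets_def clopenin_def dest: openin_subset)

lemma clopen_upsets_subset: "U \<in> clopen_upsets X r \<Longrightarrow> U \<subseteq> topspace X"
  by (auto simp: clopen_upsets_def clopenin_def dest: openin_subset)

lemma clopenin_homeomorphic_image:
  assumes f: "homeomorphic_map X Y f" and U: "U \<subseteq> topspace X"
  shows "clopenin Y (f ` U) \<longleftrightarrow> clopenin X U"
  using homeomorphic_map_openness[OF f U] homeomorphic_map_closedness[OF f U]
  by (simp add: clopenin_def)

text \<open>Clopenness is a topological invariant and downward closure an order invariant. This
  identifies the family from which \<open>eta_diamond\<close> removes sets.\<close>

lemma clopen_downsets_homeomorphic_image:
  assumes f: "homeomorphic_map X Y f" and iso: "order_isomorphism (topspace X) r (topspace Y) s f"
    and r: "r \<subseteq> topspace X \<times> topspace X" and s: "s \<subseteq> topspace Y \<times> topspace Y"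
  shows "clopen_downsets Y s = (`) f ` clopen_downsets X r"
proof -
  have bij: "bij_betw f (topspace X) (topspace Y)"
    and ord: "\<And>x y. x \<in> topspace X \<Longrightarrow> y \<in> topspace X \<Longrightarrow> (x, y) \<in> r \<longleftrightarrow> (f x, f y) \<in> s"
    using iso by (auto simp: order_isomorphism_def)
  have img: "f ` topspace X = topspace Y" and inj: "inj_on f (topspace X)"
    using bij by (auto simp: bij_betw_def)
  have image: "f ` D \<in> clopen_downsets Y s \<longleftrightarrow> D \<in> clopen_downsets X r"
    if D: "D \<subseteq> topspace X" for D
  proof -
    have mem: "f x \<in> f ` D \<longleftrightarrow> x \<in> D" if "x \<in> topspace X" for x
      using inj_on_image_mem_iff[OF inj that D] .
    \<comment> \<open>As \<open>s\<close> relates only points of Y, the quantifiers can be bounded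
      by \<open>topspace Y\<close>, the image of \<open>topspace X\<close>, and pulled back along
      \<open>f\<close>.\<close>
    have "(\<forall>x y. x \<in> f ` D \<and> (y, x) \<in> s \<longrightarrow> y \<in> f ` D) \<longleftrightarrow>
        (\<forall>x\<in>topspace Y. \<forall>y\<in>topspace Y. x \<in> f ` D \<and> (y, x) \<in> s \<longrightarrow> y \<in> f ` D)"
      using s by blast
    also have "\<dots> \<longleftrightarrow>
        (\<forall>x\<in>topspace X. \<forall>y\<in>topspace X. f x \<in> f ` D \<and> (f y, f x) \<in> s \<longrightarrow> f y \<in> f ` D)"
      unfolding img[symmetric] ball_simps ..
    also have "\<dots> \<longleftrightarrow> (\<forall>x\<in>topspace X. \<forall>y\<in>topspace X. x \<in> D \<and> (y, x) \<in> r \<longrightarrow> y \<in> D)"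
      using ord mem by auto
    also have "\<dots> \<longleftrightarrow> (\<forall>x y. x \<in> D \<and> (y, x) \<in> r \<longrightarrow> y \<in> D)"
      using r by blast
    finally show ?thesis
      by (simp add: clopen_downsets_def clopenin_homeomorphic_image[OF f D])
  qed
  show ?thesis
  proof (intro equalityI subsetI)
    fix E assume E: "E \<in> clopen_downsets Y s"
    then obtain D where "D \<subseteq> topspace X" "E = f ` D"
      using clopen_downsets_subset[OF E] unfolding img[symmetric] by (auto simp: subset_image_iff)
    with E image show "E \<in> (`) f ` clopen_downsets X r"
      by blast
  next
    fix E assume "E \<in> (`) f ` clopen_downsets X r"
    then show "E \<in> clopen_downsets Y s"
      using image clopen_downsets_subset by blast
  qed
qed

text \<open>Two distinct prime filters are told apart by some element a, in one direction or the
  other; \<open>sigma_map H a\<close> and its complement are then disjoint subbasic open sets around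
  them.\<close>

lemma Hausdorff_prime_filter_topology: "Hausdorff_space (prime_filter_topology H)"
proof (cases "carrier H = {}")
  \<comment> \<open>The subbasis is empty, so the space has no points.\<close>
  case True
  then show ?thesis
    by (auto simp: Hausdorff_space_def prime_filter_topology_def)
next
  case False
  have op: "openin (prime_filter_topology H) (sigma_map H a)"
      "openin (prime_filter_topology H) (prime_filters H - sigma_map H a)" if "a \<in> carrier H" for a
    using that by (auto simp: prime_filter_topology_def intro!: topology_generated_by_Basis)
  have sep: "\<exists>A B. openin (prime_filter_topology H) A \<and> openin (prime_filter_topology H) B
      \<and> P \<in> A \<and> Q \<in> B \<and> disjnt A B"
    if "P \<in> prime_filters H" "Q \<in> prime_filters H" "a \<in> carrier H" "a \<in> P" "a \<notin> Q" for P Q a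
    using that op[of a]
    by (intro exI[of _ "sigma_map H a"] exI[of _ "prime_filters H - sigma_map H a"])
      (auto simp: sigma_map_def disjnt_def)
  show ?thesis
    unfolding Hausdorff_space_def topspace_prime_filter_topology[OF False]
  proof (intro allI impI)
    fix P Q assume PQ: "P \<in> prime_filters H \<and> Q \<in> prime_filters H \<and> P \<noteq> Q"
    then have "P \<subseteq> carrier H" "Q \<subseteq> carrier H"
      by (auto simp: prime_filters_def lattice_filter_def)
    with PQ consider a where "a \<in> carrier H" "a \<in> P" "a \<notin> Q"
      | a where "a \<in> carrier H" "a \<in> Q" "a \<notin> P"
      by blast
    then show "\<exists>A B. openin (prime_filter_topology H) A \<and> openin (prime_filter_topology H) B
      \<and> P \<in> A \<and> Q \<in> B \<and> disjnt A B"
    proof cases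
      case (1 a)
      with PQ sep show ?thesis by blast
    next
      case (2 a)
      with PQ sep[of Q P a] show ?thesis by (metis disjnt_sym)
    qed
  qed
qed

section \<open>Prime filters of clopen up-sets are traces of points\<close>

context esakia_space
begin

lemma order_subset: "r \<subseteq> topspace X \<times> topspace X"
  using order by (auto simp: partial_order_on_def preorder_on_def)

lemma carrier_clopen_upset_algebra [simp]:
  "carrier (clopen_upset_algebra X r \<eta>\<^sub>1 \<eta>\<^sub>2) = clopen_upsets X r"
  by (simp add: clopen_upset_algebra_def)

text \<open>Replaces the abstract lattice operations by set operations; by upward closure, being
  nonempty means containing the top, and being proper means omitting the bottom.\<close>

lemma prime_filters_clopen_upset_algebra_iff:
  "P \<in> prime_filters (clopen_upset_algebra X r \<eta>\<^sub>1 \<eta>\<^sub>2) \<longleftrightarrow>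
    P \<subseteq> clopen_upsets X r \<and> topspace X \<in> P \<and> {} \<notin> P \<and>
    (\<forall>U\<in>P. \<forall>V\<in>P. U \<inter> V \<in> P) \<and>
    (\<forall>U\<in>P. \<forall>V\<in>clopen_upsets X r. U \<subseteq> V \<longrightarrow> V \<in> P) \<and>
    (\<forall>U\<in>clopen_upsets X r. \<forall>V\<in>clopen_upsets X r. U \<union> V \<in> P \<longrightarrow> U \<in> P \<or> V \<in> P)"
proof -
  let ?H = "clopen_upset_algebra X r \<eta>\<^sub>1 \<eta>\<^sub>2"
  have le: "le ?H = (\<subseteq>)"
    by (simp add: clopen_upset_algebra_def)
  have join: "(\<forall>U\<in>clopen_upsets X r. \<forall>V\<in>clopen_upsets X r. U \<squnion>\<^bsub>?H\<^esub> V \<in> P \<longrightarrow> U \<in> P \<or> V \<in> P) \<longleftrightarrow>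
      (\<forall>U\<in>clopen_upsets X r. \<forall>V\<in>clopen_upsets X r. U \<union> V \<in> P \<longrightarrow> U \<in> P \<or> V \<in> P)"
    by (intro ball_cong refl) (simp add: join_clopen_upset_algebra)
  \<comment> \<open>These translations are valid only for an upward closed P inside the carrier; for
    any other P both sides are false.\<close>
  show ?thesis
  proof (cases "P \<subseteq> clopen_upsets X r \<and> (\<forall>U\<in>P. \<forall>V\<in>clopen_upsets X r. U \<subseteq> V \<longrightarrow> V \<in> P)")
    case True
    then have sub: "U \<in> clopen_upsets X r" if "U \<in> P" for U
      using that by blast
    have "(\<forall>U\<in>P. \<forall>V\<in>P. U \<sqinter>\<^bsub>?H\<^esub> V \<in> P) \<longleftrightarrow> (\<forall>U\<in>P. \<forall>V\<in>P. U \<inter> V \<in> P)"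
      by (intro ball_cong refl) (simp add: meet_clopen_upset_algebra sub)
    moreover have "P \<noteq> {} \<longleftrightarrow> topspace X \<in> P"
      using True topspace_in_clopen_upsets clopen_upsets_subset by blast
    moreover have "P \<noteq> clopen_upsets X r \<longleftrightarrow> {} \<notin> P"
      using True empty_in_clopen_upsets by blast
    ultimately show ?thesis
      unfolding prime_filters_def lattice_filter_def mem_Collect_eq le carrier_clopen_upset_algebra
        join
      by argo
  next
    case False
    then show ?thesis
      unfolding prime_filters_def lattice_filter_def mem_Collect_eq le carrier_clopen_upset_algebra
      by argo
  qed
qed

lemma mem_epsilon_iff: "U \<in> epsilon X r x \<longleftrightarrow> U \<in> clopen_upsets X r \<and> x \<in> U"
  by (simp add: epsilon_def)

lemma epsilon_in_prime_filters:
  "x \<in> topspace X \<Longrightarrow> epsilon X r x \<in> prime_filters (clopen_upset_algebra X r \<eta>\<^sub>1 \<eta>\<^sub>2)"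
  by (auto simp: prime_filters_clopen_upset_algebra_iff mem_epsilon_iff
      topspace_in_clopen_upsets clopen_upsets_Int)

text \<open>If x is not below y, a separating clopen up-set lies in the trace of x only; the
  converse is closure of up-sets under the order.\<close>

lemma epsilon_subset_iff:
  assumes "x \<in> topspace X" "y \<in> topspace X"
  shows "epsilon X r x \<subseteq> epsilon X r y \<longleftrightarrow> (x, y) \<in> r"
  using separation[OF assms] by (fastforce simp: epsilon_def clopen_upsets_def)

lemma inj_on_epsilon: "inj_on (epsilon X r) (topspace X)"
proof (rule inj_onI)
  fix x y assume "x \<in> topspace X" "y \<in> topspace X" "epsilon X r x = epsilon X r y"
  then have "(x, y) \<in> r" "(y, x) \<in> r"
    by (simp_all flip: epsilon_subset_iff)
  with order show "x = y"
    by (auto simp: partial_order_on_def dest: antisymD)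
qed

text \<open>
  By compactness: a point in every member of \<open>P\<close> and outside every other clopen up-set exists
  because the members of \<open>P\<close> and the complements of the non-members have the finite intersection
  property, which is where primality is used.
\<close>

lemma prime_filter_eq_epsilon:
  assumes "P \<in> prime_filters (clopen_upset_algebra X r \<eta>\<^sub>1 \<eta>\<^sub>2)"
  shows "\<exists>x\<in>topspace X. P = epsilon X r x"
proof -
  let ?C = "clopen_upsets X r"
  let ?\<F> = "P \<union> (\<lambda>V. topspace X - V) ` (?C - P)"
  have P: "P \<subseteq> ?C" "topspace X \<in> P" "{} \<notin> P"
    and Int: "\<And>U V. U \<in> P \<Longrightarrow> V \<in> P \<Longrightarrow> U \<inter> V \<in> P"
    and up: "\<And>U V. U \<in> P \<Longrightarrow> V \<in> ?C \<Longrightarrow> U \<subseteq> V \<Longrightarrow> V \<in> P"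
    and prime: "\<And>U V. U \<in> ?C \<Longrightarrow> V \<in> ?C \<Longrightarrow> U \<union> V \<in> P \<Longrightarrow> U \<in> P \<or> V \<in> P"
    using assms unfolding prime_filters_clopen_upset_algebra_iff by blast+
  \<comment> \<open>The factor \<open>topspace X\<close> covers the empty family, whose intersection
    is the whole type.\<close>
  have Inter: "topspace X \<inter> \<Inter>\<A> \<in> P" if "finite \<A>" "\<A> \<subseteq> P" for \<A>
    using that
  proof (induction \<A> rule: finite_induct)
    case empty
    then show ?case using P by simp
  next
    case (insert U \<A>)
    then have "U \<inter> (topspace X \<inter> \<Inter>\<A>) \<in> P"
      using Int[of U "topspace X \<inter> \<Inter>\<A>"] by simp
    then show ?case by (simp add: Int_left_commute)
  qed
  \<comment> \<open>Primality enters here: non-members are closed under finite unions, the empty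
    union being a non-member because P is proper.\<close>
  have Union: "\<Union>\<B> \<in> ?C - P" if "finite \<B>" "\<B> \<subseteq> ?C - P" for \<B>
    using that
  proof (induction \<B> rule: finite_induct)
    case empty
    then show ?case using P empty_in_clopen_upsets by simp
  next
    case (insert V \<B>)
    then have "V \<in> ?C - P" "\<Union>\<B> \<in> ?C - P" by auto
    then show ?case
      using prime[of V "\<Union>\<B>"] by (auto simp: clopen_upsets_Un)
  qed
  have fip: "\<Inter>\<G> \<noteq> {}" if fin: "finite \<G>" and sub: "\<G> \<subseteq> ?\<F>" for \<G>
  proof
    assume empty: "\<Inter>\<G> = {}"
    have "finite (\<G> - P)" "\<G> - P \<subseteq> (\<lambda>V. topspace X - V) ` (?C - P)"
      using fin sub by auto
    then obtain \<B> where \<B>: "\<B> \<subseteq> ?C - P" "finite \<B>" "\<G> - P = (\<lambda>V. topspace X - V) ` \<B>"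
      by (auto dest: finite_subset_image)
    \<comment> \<open>A point of \<open>?A\<close> avoids some set in \<open>\<G>\<close>,
      necessarily a complement, so it lies in a member of \<open>\<B>\<close>. Upward closure then
      forces the union of \<open>\<B>\<close> into P, a contradiction.\<close>
    let ?A = "topspace X \<inter> \<Inter>(\<G> \<inter> P)"
    have "?A \<subseteq> \<Union>\<B>"
    proof
      fix x assume x: "x \<in> ?A"
      obtain G where G: "G \<in> \<G>" "x \<notin> G"
        using empty by blast
      with x have "G \<in> \<G> - P" by blast
      with \<B>(3) obtain V where "V \<in> \<B>" "G = topspace X - V" by auto
      with x G show "x \<in> \<Union>\<B>" by blast
    qed
    moreover have "?A \<in> P" "\<Union>\<B> \<in> ?C - P"
      using Inter Union fin \<B> by auto
    ultimately show False
      using up by blast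
  qed
  have "\<forall>F\<in>?\<F>. closedin X F"
    using P(1) by (auto simp: clopen_upsets_def clopenin_def)
  then obtain x where x: "x \<in> \<Inter>?\<F>"
    using compact fip unfolding compact_space_fip by (metis (lifting) ex_in_conv)
  \<comment> \<open>Lying in the members gives one inclusion, avoiding the non-members the
    other.\<close>
  have "P = epsilon X r x"
    using x P(1) clopen_upsets_subset by (auto simp: epsilon_def)
  then show ?thesis
    using x P(2) by blast
qed

section \<open>\<open>epsilon\<close> as homeomorphism and order isomorphism\<close>

lemma epsilon_image_topspace:
  "epsilon X r ` topspace X = prime_filters (clopen_upset_algebra X r \<eta>\<^sub>1 \<eta>\<^sub>2)"
  using epsilon_in_prime_filters prime_filter_eq_epsilon by blast

text \<open>Every prime filter is some \<open>epsilon X r x\<close>, and it contains U exactly when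
  x is in U.\<close>

lemma sigma_map_clopen_upset_algebra:
  assumes "U \<in> clopen_upsets X r"
  shows "sigma_map (clopen_upset_algebra X r \<eta>\<^sub>1 \<eta>\<^sub>2) U = epsilon X r ` U"
  using assms clopen_upsets_subset[OF assms]
  unfolding sigma_map_def epsilon_image_topspace[symmetric] by (auto simp: mem_epsilon_iff)

lemma prime_filters_Diff_sigma_map:
  assumes "U \<in> clopen_upsets X r"
  shows "prime_filters (clopen_upset_algebra X r \<eta>\<^sub>1 \<eta>\<^sub>2) -
    sigma_map (clopen_upset_algebra X r \<eta>\<^sub>1 \<eta>\<^sub>2) U = epsilon X r ` (topspace X - U)"
  using inj_on_image_set_diff[OF inj_on_epsilon, of "topspace X" U] clopen_upsets_subset[OF assms]
  by (simp add: sigma_map_clopen_upset_algebra[OF assms] flip: epsilon_image_topspace)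

lemma topspace_prime_filters_clopen_upset_algebra:
  "topspace (prime_filter_topology (clopen_upset_algebra X r \<eta>\<^sub>1 \<eta>\<^sub>2)) =
    prime_filters (clopen_upset_algebra X r \<eta>\<^sub>1 \<eta>\<^sub>2)"
  using empty_in_clopen_upsets by (intro topspace_prime_filter_topology) auto

lemma continuous_map_epsilon:
  "continuous_map X (prime_filter_topology (clopen_upset_algebra X r \<eta>\<^sub>1 \<eta>\<^sub>2)) (epsilon X r)"
proof -
  let ?H = "clopen_upset_algebra X r \<eta>\<^sub>1 \<eta>\<^sub>2"
  let ?\<S> = "sigma_map ?H ` carrier ?H \<union> (\<lambda>a. prime_filters ?H - sigma_map ?H a) ` carrier ?H"
  have pre: "epsilon X r -` (epsilon X r ` U) \<inter> topspace X = U" if "U \<subseteq> topspace X" for U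
    using that inj_on_epsilon by (auto dest: inj_onD)
  have op: "openin X (epsilon X r -` S \<inter> topspace X)" if S: "S \<in> ?\<S>" for S
  proof -
    from S obtain U where U: "U \<in> clopen_upsets X r"
      and "S = sigma_map ?H U \<or> S = prime_filters ?H - sigma_map ?H U"
      by auto
    then have "S = epsilon X r ` U \<or> S = epsilon X r ` (topspace X - U)"
      unfolding prime_filters_Diff_sigma_map[OF U] unfolding sigma_map_clopen_upset_algebra[OF U] by blast
    moreover have "openin X U" "openin X (topspace X - U)"
      using U by (auto simp: clopen_upsets_def clopenin_def)
    ultimately show ?thesis
      using pre openin_subset by metis
  qed
  \<comment> \<open>Continuity into a generated topology also requires the subbasis to cover the
    image.\<close>
  have "epsilon X r ` topspace X \<subseteq> \<Union>?\<S>"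
    using topspace_prime_filters_clopen_upset_algebra[of \<eta>\<^sub>1 \<eta>\<^sub>2]
    by (simp add: epsilon_image_topspace[of \<eta>\<^sub>1 \<eta>\<^sub>2] prime_filter_topology_def)
  then show ?thesis
    unfolding prime_filter_topology_def using op by (intro continuous_on_generated_topo) auto
qed

lemma homeomorphic_map_epsilon:
  "homeomorphic_map X (prime_filter_topology (clopen_upset_algebra X r \<eta>\<^sub>1 \<eta>\<^sub>2)) (epsilon X r)"
  by (intro continuous_imp_homeomorphic_map compact Hausdorff_prime_filter_topology
      continuous_map_epsilon inj_on_epsilon)
    (simp add: topspace_prime_filters_clopen_upset_algebra epsilon_image_topspace)

lemma order_isomorphism_epsilon:
  "order_isomorphism (topspace X) r (prime_filters (clopen_upset_algebra X r \<eta>\<^sub>1 \<eta>\<^sub>2))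
    (prime_filter_order (clopen_upset_algebra X r \<eta>\<^sub>1 \<eta>\<^sub>2)) (epsilon X r)"
  by (simp add: order_isomorphism_def bij_betw_def inj_on_epsilon epsilon_image_topspace
      prime_filter_order_def epsilon_in_prime_filters epsilon_subset_iff)

lemma clopen_downsets_prime_filters:
  "clopen_downsets (prime_filter_topology (clopen_upset_algebra X r \<eta>\<^sub>1 \<eta>\<^sub>2))
    (prime_filter_order (clopen_upset_algebra X r \<eta>\<^sub>1 \<eta>\<^sub>2)) =
    (`) (epsilon X r) ` clopen_downsets X r"
  using order_isomorphism_epsilon
  by (intro clopen_downsets_homeomorphic_image homeomorphic_map_epsilon order_subset)
    (auto simp: topspace_prime_filters_clopen_upset_algebra prime_filter_order_def)

end

section \<open>Transfer of the neighbourhood functions\<close>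

context modal_esakia_space
begin

text \<open>Both sides range over the same U: \<open>eta1_upsets\<close> makes neighbourhoods clopen
  up-sets, and \<open>box_closed\<close> reduces membership of the box in the trace to membership of
  x in the box.\<close>

lemma eta_box_epsilon:
  assumes x: "x \<in> topspace X"
  shows "eta_box (clopen_upset_algebra X r \<eta>\<^sub>1 \<eta>\<^sub>2) (epsilon X r x) = {epsilon X r ` U |U. U \<in> \<eta>\<^sub>1 x}"
proof -
  have box: "box (clopen_upset_algebra X r \<eta>\<^sub>1 \<eta>\<^sub>2) = box_of X \<eta>\<^sub>1"
    by (simp add: clopen_upset_algebra_def)
  have "U \<in> clopen_upsets X r \<and> box_of X \<eta>\<^sub>1 U \<in> epsilon X r x \<longleftrightarrow> U \<in> \<eta>\<^sub>1 x" for U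
    using x eta1_upsets[OF x] box_closed by (auto simp: mem_epsilon_iff box_of_def)
  then show ?thesis
    unfolding eta_box_def box carrier_clopen_upset_algebra
    by (metis (lifting) sigma_map_clopen_upset_algebra)
qed

lemma eta_diamond_epsilon:
  assumes x: "x \<in> topspace X"
  shows "eta_diamond (clopen_upset_algebra X r \<eta>\<^sub>1 \<eta>\<^sub>2) (epsilon X r x) =
    {epsilon X r ` D |D. D \<in> \<eta>\<^sub>2 x}"
proof -
  let ?H = "clopen_upset_algebra X r \<eta>\<^sub>1 \<eta>\<^sub>2"
  let ?D = "clopen_downsets X r"
  have dia: "diamond ?H = diamond_of X \<eta>\<^sub>2"
    by (simp add: clopen_upset_algebra_def)
  have mem: "diamond_of X \<eta>\<^sub>2 U \<in> epsilon X r x \<longleftrightarrow> topspace X - U \<notin> \<eta>\<^sub>2 x"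
    if "U \<in> clopen_upsets X r" for U
    using x diamond_closed[OF that] by (auto simp: mem_epsilon_iff diamond_of_def)
  have "{prime_filters ?H - sigma_map ?H U |U. U \<in> carrier ?H \<and> diamond ?H U \<in> epsilon X r x} =
      (`) (epsilon X r) ` ((-) (topspace X) ` {U \<in> clopen_upsets X r. topspace X - U \<notin> \<eta>\<^sub>2 x})"
    unfolding dia carrier_clopen_upset_algebra
    by (auto simp: mem prime_filters_Diff_sigma_map image_iff) (metis mem prime_filters_Diff_sigma_map)+
  \<comment> \<open>Complementation carries clopen up-sets onto clopen down-sets, so the removed
    sets come from the clopen down-sets outside \<open>\<eta>\<^sub>2 x\<close>.\<close>
  also have "(-) (topspace X) ` {U \<in> clopen_upsets X r. topspace X - U \<notin> \<eta>\<^sub>2 x} = ?D - \<eta>\<^sub>2 x"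
  proof (intro equalityI subsetI)
    fix D assume D: "D \<in> ?D - \<eta>\<^sub>2 x"
    then have "D = topspace X - (topspace X - D)" "topspace X - D \<in> clopen_upsets X r"
      using clopen_downsets_subset clopen_upsets_Diff[OF order_subset] by blast+
    with D show "D \<in> (-) (topspace X) ` {U \<in> clopen_upsets X r. topspace X - U \<notin> \<eta>\<^sub>2 x}"
      by auto
  qed (auto intro: clopen_downsets_Diff[OF order_subset])
  finally have "eta_diamond ?H (epsilon X r x) =
      (`) (epsilon X r) ` ?D - (`) (epsilon X r) ` (?D - \<eta>\<^sub>2 x)"
    by (simp add: eta_diamond_def clopen_downsets_prime_filters)
  \<comment> \<open>Taking images is injective on subsets of the space, hence commutes with
    difference of families.\<close>
  also have "\<dots> = (`) (epsilon X r) ` (?D - (?D - \<eta>\<^sub>2 x))"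
  proof (rule inj_on_image_set_diff[symmetric])
    show "inj_on ((`) (epsilon X r)) (Pow (topspace X))"
      by (rule inj_on_image_Pow[OF inj_on_epsilon])
  qed (use clopen_downsets_subset in auto)
  also have "?D - (?D - \<eta>\<^sub>2 x) = \<eta>\<^sub>2 x"
    using eta2_downsets[OF x] by blast
  finally show ?thesis
    by (simp add: image_def Bex_def conj_commute Setcompr_eq_image)
qed

end

theorem theorem16:
  fixes X :: "'a topology" and r :: "'a rel" and \<eta>\<^sub>1 \<eta>\<^sub>2 :: "'a \<Rightarrow> 'a set set"
  assumes "modal_esakia_space X r \<eta>\<^sub>1 \<eta>\<^sub>2"
  defines "H \<equiv> clopen_upset_algebra X r \<eta>\<^sub>1 \<eta>\<^sub>2"
  shows "homeomorphic_map X (prime_filter_topology H) (epsilon X r)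
    \<and> order_isomorphism (topspace X) r (prime_filters H) (prime_filter_order H) (epsilon X r)
    \<and> (\<forall>x\<in>topspace X.
        eta_box H (epsilon X r x) = {epsilon X r ` U |U. U \<in> \<eta>\<^sub>1 x}
      \<and> eta_diamond H (epsilon X r x) = {epsilon X r ` D |D. D \<in> \<eta>\<^sub>2 x})"
proof -
  interpret modal_esakia_space X r \<eta>\<^sub>1 \<eta>\<^sub>2
    by fact
  show ?thesis
    unfolding H_def
    by (intro conjI ballI homeomorphic_map_epsilon order_isomorphism_epsilon eta_box_epsilon
        eta_diamond_epsilon)
qed

end
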